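(* Let $B\in\mathbb{R}^{n\times r}$ have rank $r$ and rows $b_1^{\mathsf T},\dots,b_n^{\mathsf T}$. Assume $1\le k\le n$, every row $b_i$ is nonzero, and $b_i\ne\pm b_j$ for $i\ne j$. Consider the sparse-PCA problem $$\max_{x\in\mathbb{R}^n}\ x^{\mathsf T}BB^{\mathsf T}x\quad\text{s.t.}\quad\lVert x\rVert_2=1,\ \lVert x\rVert_0\le k .$$ Let $\mathcal{S}$ be the set of supports observed in the full-dimensional cells of the central arrangement in $\mathbb{R}^r$ formed by the hyperplanes $\{z:(b_i-b_j)^{\mathsf T}z=0\}$ and $\{z:(b_i+b_j)^{\mathsf T}z=0\}$, $i<j$. Then the optimal value of the sparse-PCA problem equals $$\max_{S\in\mathcal{S}}\lambda_{\max}(B_S^{\mathsf T}B_S).$$ Moreover, $$|\mathcal{S}|\le R_{\mathrm c}(n(n-1),r)=O(n^{2r-2})$$ for fixed real rank $r$.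
   Context: $\lVert x\rVert_0$ is the number of nonzero entries of $x$. $B_S$ is the submatrix of $B$ consisting of the rows indexed by $S$. The support observed in a full-dimensional cell (connected component of the complement of the hyperplanes) is the $k$-element set $S\subseteq\{1,\dots,n\}$ of indices of the $k$ largest magnitudes $|(Bz)_i|=|b_i^{\mathsf T}z|$ for $z$ in the cell (under the stated assumptions, it is unique and constant on the cell). $R_{\mathrm c}(N,d)=1$ if $d=0$ or $N=0$, and $R_{\mathrm c}(N,d)=2\sum_{j=0}^{d-1}\binom{N-1}{j}$ if $d\ge1$ and $N\ge1$. *)

theory Defs
  imports "HOL-Analysis.Analysis" "HOL-Library.Landau_Symbols"
begin

definition nnz :: "real^'n \<Rightarrow> nat"
  where "nnz x = card {i. x $ i \<noteq> 0}"

definition spca_feasible :: "nat \<Rightarrow> (real^'n) set"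
  where "spca_feasible k = {x. norm x = 1 \<and> nnz x \<le> k}"

definition spca_objective :: "real^'r^'n \<Rightarrow> real^'n \<Rightarrow> real"
  where "spca_objective B x = x \<bullet> ((B ** transpose B) *v x)"

(* The problem is stated with "max", so an optimal value has to be attained. *)
definition is_spca_optimal_value :: "real^'r^'n \<Rightarrow> nat \<Rightarrow> real \<Rightarrow> bool"
  where "is_spca_optimal_value B k v \<longleftrightarrow>
    (\<exists>x \<in> spca_feasible k. spca_objective B x = v) \<and>
    (\<forall>x \<in> spca_feasible k. spca_objective B x \<le> v)"

definition eigenvalues :: "real^'r^'r \<Rightarrow> real set"
  where "eigenvalues A = {c. \<exists>v. v \<noteq> 0 \<and> A *v v = c *\<^sub>R v}"

definition lambda_max :: "real^'r^'r \<Rightarrow> real"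
  where "lambda_max A = Max (eigenvalues A)"

(* The product of the transpose of B_S with B_S, where B_S consists of the rows of B indexed
   by S.  As row indices are types, B_S itself is not formed; the entries of the product are
   written out instead, with the summation index ranging over the rows of B_S. *)
definition rows_gram :: "real^'r^'n \<Rightarrow> 'n set \<Rightarrow> real^'r^'r"
  where "rows_gram B S = (\<chi> a b. \<Sum>i\<in>S. B $ i $ a * B $ i $ b)"

lemma rows_gram_UNIV: "rows_gram B UNIV = transpose B ** B"
  by (simp add: rows_gram_def matrix_matrix_mult_def transpose_def)

definition hyperplanes :: "real^'r^('n::{finite,linorder}) \<Rightarrow> (real^'r) set set"
  where "hyperplanes B =
    {{z. (row i B - row j B) \<bullet> z = 0} | i j. i < j} \<union>
    {{z. (row i B + row j B) \<bullet> z = 0} | i j. i < j}"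

definition cells :: "real^'r^('n::{finite,linorder}) \<Rightarrow> (real^'r) set set"
  where "cells B = components (- \<Union> (hyperplanes B))"

definition is_top_support :: "real^'r^'n \<Rightarrow> nat \<Rightarrow> real^'r \<Rightarrow> 'n set \<Rightarrow> bool"
  where "is_top_support B k z S \<longleftrightarrow>
    card S = k \<and> (\<forall>i\<in>S. \<forall>j\<in>-S. \<bar>(B *v z) $ j\<bar> \<le> \<bar>(B *v z) $ i\<bar>)"

(* Ties of magnitudes occur only on the hyperplanes, so each cell contributes one support. *)
definition observed_supports :: "real^'r^('n::{finite,linorder}) \<Rightarrow> nat \<Rightarrow> 'n set set"
  where "observed_supports B k = {S. \<exists>C \<in> cells B. \<forall>z\<in>C. is_top_support B k z S}"

definition Rc :: "nat \<Rightarrow> nat \<Rightarrow> nat"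
  where "Rc N d = (if d = 0 \<or> N = 0 then 1 else 2 * (\<Sum>j = 0..d - 1. (N - 1) choose j))"

end

theory Submission
  imports Defs
begin

text \<open>For feasible \<open>x\<close> supported in \<open>T\<close>, the vector \<open>w\<close>, the transpose of \<open>B\<close> times \<open>x\<close>, satisfies
  \<open>|w|^4 \<le> \<Sum>i\<in>T. (b_i \<bullet> w)^2\<close> by Cauchy-Schwarz. For \<open>z\<close> off the hyperplanes, the same sum at \<open>z\<close> grows when
  \<open>T\<close> is replaced by the top support of \<open>z\<close>, hence is at most \<open>M * |z|^2\<close> with \<open>M\<close> the largest observed
  eigenvalue; by density this holds at \<open>w\<close>, so \<open>|w|^2 \<le> M\<close>. A top eigenvector \<open>v\<close> for an optimal support \<open>S\<close>
  gives the maximiser, \<open>B_S v\<close> normalised. A top support is determined by the signs of the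
  functionals \<open>b_i \<plusminus> b_j\<close>, and sign patterns are counted as in Cover's theorem.\<close>

section \<open>Sign patterns of linear functionals\<close>

text \<open>Each pattern stands for a region that the functionals in \<open>A\<close> cut out of
  \<open>V\<close>. The subspace is a parameter so that restriction to a hyperplane stays within the
  notion.\<close>

definition sign_patterns :: "'a::euclidean_space set \<Rightarrow> 'a set \<Rightarrow> 'a set set"
  where "sign_patterns V A = (\<lambda>z. {a\<in>A. 0 < a \<bullet> z}) ` {z\<in>V. \<forall>a\<in>A. a \<bullet> z \<noteq> 0}"

text \<open>Cover's number of regions for \<open>m\<close> central hyperplanes in general position
  in dimension \<open>d\<close>. Unlike \<open>Rc\<close> it is 0 for \<open>d = 0\<close> and
  \<open>m > 0\<close>, as the recursion on the dimension requires.\<close>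

definition cover_count :: "nat \<Rightarrow> nat \<Rightarrow> nat"
  where "cover_count m d = (if m = 0 then 1 else 2 * (\<Sum>j<d. (m - 1) choose j))"

text \<open>Pascal's rule, summand by summand after an index shift.\<close>

lemma cover_count_Suc: "cover_count m (Suc d) + cover_count m d \<le> cover_count (Suc m) (Suc d)"
proof (cases m)
  case 0
  then show ?thesis
    by (simp add: cover_count_def sum.lessThan_Suc_shift del: sum.lessThan_Suc)
next
  case (Suc l)
  then show ?thesis
    by (simp add: cover_count_def sum.lessThan_Suc_shift sum.distrib del: sum.lessThan_Suc)
qed

lemma finite_sign_patterns: "finite A \<Longrightarrow> finite (sign_patterns V A)"
  by (rule finite_subset[of _ "Pow A"]) (auto simp: sign_patterns_def)

text \<open>Points realising the two patterns lie on opposite sides of the hyperplane of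
  \<open>a\<close> and agree in all other signs, so the segment between them crosses it while every
  other sign is kept.\<close>

lemma sign_patterns_both_sides:
  assumes V: "subspace V" and a: "a \<notin> A"
    and "P \<in> sign_patterns V (insert a A)" "insert a P \<in> sign_patterns V (insert a A)" "a \<notin> P"
  shows "P \<in> sign_patterns (V \<inter> {z. a \<bullet> z = 0}) A"
proof -
  obtain y where y: "y \<in> V" "\<forall>b\<in>insert a A. b \<bullet> y \<noteq> 0" "P = {b\<in>insert a A. 0 < b \<bullet> y}"
    using assms(3) by (auto simp: sign_patterns_def)
  obtain x where x: "x \<in> V" "\<forall>b\<in>insert a A. b \<bullet> x \<noteq> 0" "insert a P = {b\<in>insert a A. 0 < b \<bullet> x}"
    using assms(4) by (force simp: sign_patterns_def)
  have ay: "a \<bullet> y < 0" using y assms(5) by force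
  have ax: "a \<bullet> x > 0" using x by blast
  \<comment> \<open>A positive multiple of the crossing point: the weights
    \<open>a \<bullet> x\<close> and \<open>- (a \<bullet> y)\<close> are positive and make
    \<open>a \<bullet> z\<close> vanish.\<close>
  define z where "z = (a \<bullet> x) *\<^sub>R y - (a \<bullet> y) *\<^sub>R x"
  have zV: "z \<in> V" unfolding z_def using V x y by (intro subspace_diff subspace_scale)
  have az: "a \<bullet> z = 0" by (simp add: z_def inner_diff_right)
  have bz: "b \<bullet> z \<noteq> 0 \<and> (0 < b \<bullet> z \<longleftrightarrow> b \<in> P)" if b: "b \<in> A" for b
  proof (cases "b \<in> P")
    case True
    then have "0 < b \<bullet> y" "0 < b \<bullet> x" using x(3) y(3) by blast+
    then have "0 < (a \<bullet> x) * (b \<bullet> y)" "0 < - (a \<bullet> y) * (b \<bullet> x)"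
      using ax ay by (auto intro: mult_pos_pos mult_neg_pos simp del: mult_minus_left)
    then have "0 < b \<bullet> z" by (simp add: z_def inner_diff_right)
    with True show ?thesis by simp
  next
    case False
    moreover have "b \<noteq> a" using a b by blast
    ultimately have "b \<bullet> y < 0" "b \<bullet> x < 0" using x(2,3) y(2,3) b by force+
    then have "(a \<bullet> x) * (b \<bullet> y) < 0" "- (a \<bullet> y) * (b \<bullet> x) < 0"
      using ax ay by (auto intro: mult_pos_neg mult_neg_neg)
    then have "b \<bullet> z < 0" by (simp add: z_def inner_diff_right)
    with False show ?thesis by simp
  qed
  have "P \<subseteq> A" using y(3) assms(5) by blast
  then have "P = {b\<in>A. 0 < b \<bullet> z}" using bz by blast
  then show ?thesis using zV az bz by (auto simp: sign_patterns_def)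
qed

lemma sign_patterns_insert_subset:
  assumes "P \<in> sign_patterns V (insert a A)" "a \<notin> A"
  shows "P - {a} \<in> sign_patterns V A"
  using assms by (force simp: sign_patterns_def)

text \<open>Erasing \<open>a\<close> identifies only \<open>P\<close> with
  \<open>insert a P\<close>. Once the smaller member of each such pair is set aside in
  \<open>?U\<close>, erasure is injective; \<open>?U\<close> itself is counted on the
  hyperplane.\<close>

lemma card_sign_patterns_insert:
  assumes V: "subspace V" and "finite A" "a \<notin> A"
  shows "card (sign_patterns V (insert a A))
    \<le> card (sign_patterns V A) + card (sign_patterns (V \<inter> {z. a \<bullet> z = 0}) A)"
proof -
  let ?S = "sign_patterns V (insert a A)"
  let ?U = "{P\<in>?S. a \<notin> P \<and> insert a P \<in> ?S}"
  have fin: "finite ?S" using assms by (simp add: finite_sign_patterns)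
  have "inj_on (\<lambda>P. P - {a}) (?S - ?U)"
  proof (rule inj_onI)
    fix P Q assume P: "P \<in> ?S - ?U" and Q: "Q \<in> ?S - ?U" and eq: "P - {a} = Q - {a}"
    show "P = Q"
    proof (cases "a \<in> P \<longleftrightarrow> a \<in> Q")
      case True
      then show ?thesis using eq by blast
    next
      case False
      then have "Q = insert a P \<and> a \<notin> P \<or> P = insert a Q \<and> a \<notin> Q" using eq by blast
      then show ?thesis using P Q by auto
    qed
  qed
  then have "card (?S - ?U) \<le> card (sign_patterns V A)"
    by (rule card_inj_on_le)
      (use assms in \<open>auto simp: finite_sign_patterns intro: sign_patterns_insert_subset\<close>)
  moreover have "card ?U \<le> card (sign_patterns (V \<inter> {z. a \<bullet> z = 0}) A)"
    by (rule card_mono)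
      (use assms in \<open>auto simp: finite_sign_patterns intro: sign_patterns_both_sides\<close>)
  moreover have "card ?S = card (?S - ?U) + card ?U"
    using card_Diff_subset[of ?U ?S] card_mono[of ?S ?U] fin by auto
  ultimately show ?thesis by linarith
qed

text \<open>Deletion-restriction: a pattern on \<open>A\<close> extends in two ways to \<open>insert a A\<close> only if it
  already occurs on the hyperplane orthogonal to \<open>a\<close>.\<close>
lemma card_sign_patterns_le:
  fixes A :: "'a::euclidean_space set"
  assumes "finite A" "subspace V" "dim V \<le> d"
  shows "card (sign_patterns V A) \<le> cover_count (card A) d"
  using assms
proof (induction A arbitrary: V d rule: finite_induct)
  case empty
  have "sign_patterns V {} \<subseteq> {{}}" by (auto simp: sign_patterns_def)
  then have "card (sign_patterns V {}) \<le> card {{} :: 'a set}" by (intro card_mono) auto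
  then show ?case by (simp add: cover_count_def)
next
  case (insert a A)
  let ?H = "V \<inter> {z. a \<bullet> z = 0}"
  show ?case
  proof (cases "V \<subseteq> {z. a \<bullet> z = 0}")
    case True
    then have "sign_patterns V (insert a A) = {}" by (auto simp: sign_patterns_def)
    then show ?thesis by simp
  next
    case False
    have sub: "subspace ?H" using insert.prems by (intro subspace_inter subspace_hyperplane)
    \<comment> \<open>\<open>V\<close> is not contained in the hyperplane, so the dimension drops;
      this also rules out \<open>d = 0\<close>.\<close>
    have "\<not> dim V \<le> dim ?H"
      using subspace_dim_equal[of ?H V] sub insert.prems False by blast
    then obtain e where e: "d = Suc e" "dim ?H \<le> e" using insert.prems(2) by (cases d) auto
    have "card (sign_patterns V (insert a A)) \<le> cover_count (card A) d + cover_count (card A) e"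
      using card_sign_patterns_insert[of V A a] insert.IH[OF insert.prems] insert.IH[OF sub e(2)]
        insert.hyps insert.prems(1) by linarith
    also have "\<dots> \<le> cover_count (card (insert a A)) d"
      using cover_count_Suc[of "card A" e] insert.hyps e by simp
    finally show ?thesis .
  qed
qed

section \<open>Comparison with \<open>Rc\<close> and its growth\<close>

lemma cover_count_le_Rc:
  assumes "m \<le> N" "d \<noteq> 0"
  shows "cover_count m d \<le> Rc N d"
proof (cases "m = 0")
  case True
  have "1 \<le> (\<Sum>j = 0..d - 1. (N - 1) choose j)"
    by (subst sum.atLeast_Suc_atMost) auto
  then have "1 \<le> Rc N d" by (auto simp: Rc_def)
  then show ?thesis using True by (simp add: cover_count_def)
next
  case False
  have "{0..d - 1} = {..<d}" using assms by auto
  then have "(\<Sum>j<d. (m - 1) choose j) \<le> (\<Sum>j = 0..d - 1. (N - 1) choose j)"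
    using assms(1) by (simp only:) (intro sum_mono binomial_right_mono diff_le_mono)
  then show ?thesis using False assms unfolding cover_count_def Rc_def by simp
qed

text \<open>Each of the \<open>d\<close> binomials is at most \<open>(n ^ 2) ^ j\<close> with
  \<open>j \<le> d - 1\<close>. The constant is the factor 2 of \<open>Rc\<close> times the number
  of summands.\<close>

lemma Rc_pairs_bigo:
  assumes "d \<noteq> 0"
  shows "(\<lambda>n. real (Rc (n * (n - 1)) d)) \<in> O(\<lambda>n. real n ^ (2 * d - 2))"
proof (rule bigoI[where c = "2 * real d"])
  have "Rc (n * (n - 1)) d \<le> 2 * d * n ^ (2 * d - 2)" if n: "1 \<le> n" for n
  proof -
    have "(n * (n - 1) - 1) choose j \<le> n ^ (2 * d - 2)" if "j \<in> {0..d - 1}" for j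
    proof -
      have "(n * (n - 1) - 1) choose j \<le> (n * (n - 1) - 1) ^ j"
        by (cases "j \<le> n * (n - 1) - 1") (auto intro: binomial_le_pow simp: binomial_eq_0 not_le)
      also have "\<dots> \<le> (n ^ 2) ^ j"
        by (intro power_mono) (auto simp: power2_eq_square intro!: le_trans[OF diff_le_self] mult_le_mono)
      also have "\<dots> = n ^ (2 * j)" by (simp add: power_mult)
      also have "\<dots> \<le> n ^ (2 * d - 2)" using that n by (intro power_increasing) auto
      finally show ?thesis .
    qed
    then have "(\<Sum>j = 0..d - 1. (n * (n - 1) - 1) choose j) \<le> card {0..d - 1} * n ^ (2 * d - 2)"
      using sum_bounded_above[of "{0..d - 1}" "\<lambda>j. (n * (n - 1) - 1) choose j" "n ^ (2 * d - 2)"]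
      by simp
    \<comment> \<open>For the value 1 that \<open>Rc\<close> takes at \<open>n = 1\<close>, where
      there are no pairs.\<close>
    moreover have "1 \<le> d * n ^ (2 * d - 2)" using n assms by simp
    ultimately show ?thesis using assms unfolding Rc_def by (auto simp: Suc_le_eq)
  qed
  then have "real (Rc (n * (n - 1)) d) \<le> 2 * real d * real n ^ (2 * d - 2)" if "1 \<le> n" for n
    using that of_nat_mono[of "Rc (n * (n - 1)) d" "2 * d * n ^ (2 * d - 2)", where 'a = real] by simp
  then show "\<forall>\<^sub>F n in sequentially. norm (real (Rc (n * (n - 1)) d)) \<le> 2 * real d * norm (real n ^ (2 * d - 2))"
    by (auto simp: eventually_sequentially intro!: exI[of _ 1])
qed

section \<open>The largest eigenvalue\<close>

lemma symmetric_inner: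
  fixes A :: "real^'r^'r"
  assumes "transpose A = A"
  shows "x \<bullet> (A *v y) = (A *v x) \<bullet> y"
  using assms by (metis dot_lmul_matrix transpose_matrix_vector)

text \<open>Eigenvectors of a symmetric matrix for distinct eigenvalues are orthogonal, hence
  independent. Finiteness is what gives \<open>Max\<close> in \<open>lambda_max\<close> its
  meaning.\<close>

lemma finite_eigenvalues:
  fixes A :: "real^'r^'r"
  assumes "transpose A = A"
  shows "finite (eigenvalues A)"
proof -
  have "\<forall>c\<in>eigenvalues A. \<exists>v. v \<noteq> 0 \<and> A *v v = c *\<^sub>R v"
    by (simp add: eigenvalues_def)
  then obtain f where f: "\<And>c. c \<in> eigenvalues A \<Longrightarrow> f c \<noteq> 0 \<and> A *v f c = c *\<^sub>R f c"
    by (auto dest!: bchoice)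
  have orth: "f c \<bullet> f d = 0" if "c \<in> eigenvalues A" "d \<in> eigenvalues A" "c \<noteq> d" for c d
  proof -
    have "d * (f c \<bullet> f d) = c * (f c \<bullet> f d)"
      using symmetric_inner[OF assms, of "f c" "f d"] f that by simp
    then show ?thesis using that by simp
  qed
  have inj: "inj_on f (eigenvalues A)"
    by (rule inj_onI) (metis orth f inner_eq_zero_iff)
  have "pairwise orthogonal (f ` eigenvalues A)"
    using orth by (auto simp: pairwise_def orthogonal_def)
  moreover have "0 \<notin> f ` eigenvalues A" using f by force
  ultimately have "independent (f ` eigenvalues A)"
    by (rule pairwise_orthogonal_independent)
  then have "finite (f ` eigenvalues A)" by (rule independent_imp_finite)
  then show ?thesis using inj finite_imageD by blast
qed

text \<open>The quadratic form attains a maximum \<open>c\<close> on the compact unit sphere; by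
  first variation a maximiser is an eigenvector.\<close>

lemma max_rayleigh_eigenvector:
  fixes A :: "real^'r^'r"
  assumes sym: "transpose A = A"
  obtains c v where "v \<noteq> 0" "A *v v = c *\<^sub>R v" "\<And>z. z \<bullet> (A *v z) \<le> c * (norm z)\<^sup>2"
proof -
  have "continuous_on (sphere 0 1) (\<lambda>z. z \<bullet> (A *v z))"
    by (intro continuous_intros matrix_vector_mult_linear_continuous_on)
  moreover have "sphere (0::real^'r) 1 \<noteq> {}" by simp
  ultimately obtain v where v: "norm v = 1"
    and max: "\<And>z. norm z = 1 \<Longrightarrow> z \<bullet> (A *v z) \<le> v \<bullet> (A *v v)"
    using continuous_attains_sup[of "sphere (0::real^'r) 1" "\<lambda>z. z \<bullet> (A *v z)"] by auto
  define c where "c = v \<bullet> (A *v v)"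
  have le: "z \<bullet> (A *v z) \<le> c * (norm z)\<^sup>2" for z
  proof (cases "z = 0")
    case False
    have "(z /\<^sub>R norm z) \<bullet> (A *v (z /\<^sub>R norm z)) \<le> c"
      unfolding c_def by (rule max) (use False in simp)
    then have "(z \<bullet> (A *v z)) / (norm z)\<^sup>2 \<le> c"
      by (simp add: matrix_vector_mult_scaleR power2_eq_square divide_simps)
    then show ?thesis using False by (simp add: divide_simps)
  qed simp
  \<comment> \<open>The residual of the eigenvalue equation: unless it is zero, a small move from
    \<open>v\<close> against \<open>u\<close> would raise the Rayleigh quotient above
    \<open>c\<close>.\<close>
  define u where "u = c *\<^sub>R v - A *v v"
  define q where "q = c * (norm u)\<^sup>2 - u \<bullet> (A *v u)"
  have ineq: "0 \<le> 2 * t * (norm u)\<^sup>2 + t\<^sup>2 * q" for t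
  proof -
    have "c * (norm (v + t *\<^sub>R u))\<^sup>2 - (v + t *\<^sub>R u) \<bullet> (A *v (v + t *\<^sub>R u))
      = (c * (norm v)\<^sup>2 - v \<bullet> (A *v v)) + 2 * t * (u \<bullet> (c *\<^sub>R v - A *v v)) + t\<^sup>2 * q"
      using symmetric_inner[OF sym, of v u]
      unfolding q_def power2_norm_eq_inner
      by (simp add: matrix_vector_right_distrib matrix_vector_mult_scaleR
          inner_simps inner_commute power2_eq_square algebra_simps)
    also have "c * (norm v)\<^sup>2 - v \<bullet> (A *v v) = 0" using v by (simp add: c_def)
    finally have "c * (norm (v + t *\<^sub>R u))\<^sup>2 - (v + t *\<^sub>R u) \<bullet> (A *v (v + t *\<^sub>R u))
      = 2 * t * (norm u)\<^sup>2 + t\<^sup>2 * q" by (simp add: u_def[symmetric] power2_norm_eq_inner)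
    then show ?thesis using le[of "v + t *\<^sub>R u"] by linarith
  qed
  have "u = 0"
  proof (rule ccontr)
    assume "u \<noteq> 0"
    then have p: "(norm u)\<^sup>2 > 0" by simp
    have q: "0 \<le> q" using le[of u] by (simp add: q_def)
    \<comment> \<open>Negative, and small enough for the linear term to dominate; the
      \<open>+ 1\<close> covers \<open>q = 0\<close>.\<close>
    define t where "t = - (norm u)\<^sup>2 / (q + 1)"
    have t: "t < 0" using p q by (simp add: t_def divide_neg_pos)
    have "t * q > - 2 * (norm u)\<^sup>2" using p q by (simp add: t_def field_simps add_strict_increasing add_pos_nonneg)
    then have "0 < 2 * (norm u)\<^sup>2 + t * q" by simp
    then have "t * (2 * (norm u)\<^sup>2 + t * q) < 0" using t by (rule mult_neg_pos[rotated])
    then show False using ineq[of t] by (simp add: algebra_simps power2_eq_square)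
  qed
  then have "A *v v = c *\<^sub>R v" by (simp add: u_def)
  moreover have "v \<noteq> 0" using v by auto
  ultimately show thesis using that le by blast
qed

text \<open>The spectrum is finite and contains the maximal Rayleigh quotient \<open>c\<close>, so
  \<open>Max\<close> is attained and dominates \<open>c\<close>.\<close>

lemma
  fixes A :: "real^'r^'r"
  assumes sym: "transpose A = A"
  shows lambda_max_eigenvalue: "lambda_max A \<in> eigenvalues A"
    and rayleigh_le_lambda_max: "z \<bullet> (A *v z) \<le> lambda_max A * (norm z)\<^sup>2"
proof -
  obtain c v where v: "v \<noteq> 0" "A *v v = c *\<^sub>R v"
    and le: "\<And>z. z \<bullet> (A *v z) \<le> c * (norm z)\<^sup>2"
    using max_rayleigh_eigenvector[OF sym] by blast
  have c: "c \<in> eigenvalues A" using v by (auto simp: eigenvalues_def)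
  then show "lambda_max A \<in> eigenvalues A"
    unfolding lambda_max_def using finite_eigenvalues[OF sym] by (intro Max_in) auto
  have "c \<le> lambda_max A"
    unfolding lambda_max_def using finite_eigenvalues[OF sym] c by (rule Max_ge)
  then have "c * (norm z)\<^sup>2 \<le> lambda_max A * (norm z)\<^sup>2" by (rule mult_right_mono) simp
  then show "z \<bullet> (A *v z) \<le> lambda_max A * (norm z)\<^sup>2" using le[of z] by linarith
qed

section \<open>Gram matrices of row sets\<close>

lemma rows_gram_symmetric: "transpose (rows_gram B S) = rows_gram B S"
  by (simp add: rows_gram_def transpose_def mult.commute)

lemma rows_gram_mult: "rows_gram B S *v z = (\<Sum>i\<in>S. (row i B \<bullet> z) *\<^sub>R row i B)"
proof -
  have "(\<Sum>b\<in>UNIV. (\<Sum>i\<in>S. B $ i $ a * B $ i $ b) * z $ b)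
    = (\<Sum>i\<in>S. (\<Sum>b\<in>UNIV. B $ i $ b * z $ b) * B $ i $ a)" for a
    by (simp add: sum_distrib_right sum_distrib_left mult_ac, rule sum.swap)
  then show ?thesis
    by (simp add: vec_eq_iff rows_gram_def matrix_vector_mult_def row_def inner_vec_def)
qed

lemma rows_gram_quadratic: "z \<bullet> (rows_gram B S *v z) = (\<Sum>i\<in>S. (row i B \<bullet> z)\<^sup>2)"
  by (simp add: rows_gram_mult inner_sum_right power2_eq_square inner_commute)

lemma matrix_vector_nth: "((B::real^'r^'n) *v z) $ i = row i B \<bullet> z"
  by (simp add: matrix_vector_mul_component row_def)

lemma transpose_mult_rows: "transpose (B::real^'r^'n) *v x = (\<Sum>i\<in>UNIV. x $ i *\<^sub>R row i B)"
  by (simp add: vec_eq_iff matrix_vector_mult_def transpose_def row_def mult.commute)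

section \<open>The sparse-PCA objective: upper estimate and attainment\<close>

lemma spca_objective_eq: "spca_objective B x = (norm (transpose B *v x))\<^sup>2"
proof -
  have "(B ** transpose B) *v x = B *v (transpose B *v x)"
    by (rule matrix_vector_mul_assoc[symmetric])
  then show ?thesis
    by (simp only: spca_objective_def power2_norm_eq_inner transpose_matrix_vector dot_lmul_matrix)
qed

text \<open>Expanding one factor of \<open>w \<bullet> w\<close> in the rows gives a sum over
  \<open>S\<close> weighted by the entries of \<open>x\<close>; Cauchy-Schwarz and
  \<open>norm x = 1\<close> bound its square.\<close>

lemma norm_transpose_mult_le:
  fixes B :: "real^'r^'n"
  assumes "norm x = 1" "{i. x $ i \<noteq> 0} \<subseteq> S"
  defines "w \<equiv> transpose B *v x"
  shows "(norm w) ^ 4 \<le> (\<Sum>i\<in>S. (row i B \<bullet> w)\<^sup>2)"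
proof -
  have "w = (\<Sum>i\<in>UNIV. x $ i *\<^sub>R row i B)" unfolding w_def by (rule transpose_mult_rows)
  also have "\<dots> = (\<Sum>i\<in>S. x $ i *\<^sub>R row i B)"
    using assms(2) by (intro sum.mono_neutral_right) auto
  finally have "w \<bullet> w = (\<Sum>i\<in>S. x $ i * (row i B \<bullet> w))"
    by (metis (no_types, lifting) inner_scaleR_left inner_sum_left sum.cong)
  then have "(w \<bullet> w)\<^sup>2 \<le> (\<Sum>i\<in>S. (x $ i)\<^sup>2) * (\<Sum>i\<in>S. (row i B \<bullet> w)\<^sup>2)"
    using Cauchy_Schwarz_ineq_sum[of "\<lambda>i. x $ i" "\<lambda>i. row i B \<bullet> w" S] by simp
  also have "(\<Sum>i\<in>S. (x $ i)\<^sup>2) \<le> 1"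
  proof -
    have "(\<Sum>i\<in>S. (x $ i)\<^sup>2) \<le> (\<Sum>i\<in>UNIV. (x $ i)\<^sup>2)" by (intro sum_mono2) auto
    also have "\<dots> = (norm x)\<^sup>2" unfolding power2_norm_eq_inner by (simp add: inner_vec_def power2_eq_square)
    finally show ?thesis using assms(1) by simp
  qed
  then have "(\<Sum>i\<in>S. (x $ i)\<^sup>2) * (\<Sum>i\<in>S. (row i B \<bullet> w)\<^sup>2) \<le> 1 * (\<Sum>i\<in>S. (row i B \<bullet> w)\<^sup>2)"
    by (rule mult_right_mono) (simp add: sum_nonneg)
  finally show ?thesis by (simp add: power2_norm_eq_inner[symmetric])
qed

text \<open>With \<open>y\<close> the vector \<open>B_S v\<close> padded by zeros,
  \<open>transpose B *v y = c *\<^sub>R v\<close> and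
  \<open>(norm y)\<^sup>2 = c * (norm v)\<^sup>2\<close>, so the normalised \<open>y\<close> has
  value \<open>c\<close>. Positivity of \<open>c\<close> keeps \<open>y\<close> nonzero.\<close>

lemma spca_attains_eigenvalue:
  fixes B :: "real^'r^'n"
  assumes "c \<in> eigenvalues (rows_gram B S)" "0 < c" "card S \<le> k"
  obtains x where "x \<in> spca_feasible k" "spca_objective B x = c"
proof -
  obtain v where v: "v \<noteq> 0" "rows_gram B S *v v = c *\<^sub>R v"
    using assms(1) by (auto simp: eigenvalues_def)
  define y :: "real^'n" where "y = (\<chi> i. if i \<in> S then row i B \<bullet> v else 0)"
  have "y \<bullet> y = (\<Sum>i\<in>S. (row i B \<bullet> v)\<^sup>2)"
    by (simp add: y_def inner_vec_def power2_eq_square if_distrib sum.If_cases cong: if_cong)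
  also have "\<dots> = c * (norm v)\<^sup>2"
    using rows_gram_quadratic[of v B S] v by (simp add: power2_norm_eq_inner)
  finally have ny: "(norm y)\<^sup>2 = c * (norm v)\<^sup>2" by (simp add: power2_norm_eq_inner)
  have y0: "norm y \<noteq> 0" using ny v assms(2) by auto
  have "transpose B *v y = (\<Sum>i\<in>S. (row i B \<bullet> v) *\<^sub>R row i B)"
    unfolding transpose_mult_rows by (simp add: y_def if_distrib if_distribR sum.If_cases cong: if_cong)
  then have Ty: "transpose B *v y = c *\<^sub>R v" using v by (simp add: rows_gram_mult)
  define x where "x = y /\<^sub>R norm y"
  have "{i. x $ i \<noteq> 0} \<subseteq> S" by (auto simp: x_def y_def)
  then have "nnz x \<le> k" using card_mono[of S] assms(3) unfolding nnz_def by (meson finite le_trans)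
  moreover have "norm x = 1" using y0 by (simp add: x_def)
  moreover have "spca_objective B x = c"
  proof -
    have "transpose B *v x = (c / norm y) *\<^sub>R v"
      unfolding x_def matrix_vector_mult_scaleR Ty by (simp add: divide_inverse_commute)
    then have "spca_objective B x = c\<^sup>2 * (norm v)\<^sup>2 / (norm y)\<^sup>2"
      unfolding spca_objective_eq by (simp add: power_mult_distrib power_divide)
    then show ?thesis using ny v assms(2) by (simp add: power2_eq_square)
  qed
  ultimately show thesis using that by (simp add: spca_feasible_def)
qed

section \<open>Top supports and cells\<close>

text \<open>Greedy choice: an index of largest magnitude outside the current set is added, with ties
  broken arbitrarily.\<close>

lemma top_support_exists:
  assumes "k \<le> CARD('n)"
  shows "\<exists>S. is_top_support (B::real^'r^'n) k z S"
  using assms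
proof (induction k)
  case 0
  show ?case by (rule exI[of _ "{}"]) (simp add: is_top_support_def)
next
  case (Suc k)
  let ?f = "\<lambda>i. \<bar>(B *v z) $ i\<bar>"
  obtain S where S: "card S = k" "\<forall>i\<in>S. \<forall>j\<in>-S. ?f j \<le> ?f i"
    using Suc by (auto simp: is_top_support_def)
  have ne: "- S \<noteq> {}" using S(1) Suc.prems by (metis Compl_empty_eq Suc_n_not_le_n double_compl)
  then have "Max (?f ` (- S)) \<in> ?f ` (- S)" by (intro Max_in) auto
  then obtain m where m: "m \<in> - S" "Max (?f ` (- S)) = ?f m" by blast
  then have "?f j \<le> ?f m" if "j \<in> - S" for j
    using that Max_ge[of "?f ` (- S)" "?f j"] by simp
  have "is_top_support B (Suc k) z (insert m S)"
    using S m(1) \<open>\<And>j. j \<in> - S \<Longrightarrow> ?f j \<le> ?f m\<close> by (auto simp: is_top_support_def)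
  then show ?case by blast
qed

text \<open>Exchange argument: \<open>T - S\<close> injects into \<open>S - T\<close>, and each
  index is replaced by one of at least the same magnitude.\<close>

lemma top_support_sum_max:
  fixes B :: "real^'r^'n"
  assumes S: "is_top_support B k z S" and T: "card T \<le> k"
  shows "(\<Sum>i\<in>T. (row i B \<bullet> z)\<^sup>2) \<le> (\<Sum>i\<in>S. (row i B \<bullet> z)\<^sup>2)"
proof -
  have "card (T - S) \<le> card (S - T)"
    using S T card_le_sym_Diff[of T S] by (simp add: is_top_support_def)
  then obtain g where g: "inj_on g (T - S)" "g ` (T - S) \<subseteq> S - T"
    using card_le_inj[of "T - S" "S - T"] by auto
  have "(\<Sum>i\<in>T - S. (row i B \<bullet> z)\<^sup>2) \<le> (\<Sum>i\<in>T - S. (row (g i) B \<bullet> z)\<^sup>2)"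
  proof (rule sum_mono)
    fix i assume "i \<in> T - S"
    then have "g i \<in> S" "i \<in> - S" using g by auto
    then have "\<bar>row i B \<bullet> z\<bar> \<le> \<bar>row (g i) B \<bullet> z\<bar>"
      using S by (simp add: is_top_support_def matrix_vector_nth)
    then show "(row i B \<bullet> z)\<^sup>2 \<le> (row (g i) B \<bullet> z)\<^sup>2" by (simp add: abs_le_square_iff)
  qed
  also have "\<dots> = (\<Sum>i\<in>g ` (T - S). (row i B \<bullet> z)\<^sup>2)" using g by (simp add: sum.reindex)
  also have "\<dots> \<le> (\<Sum>i\<in>S - T. (row i B \<bullet> z)\<^sup>2)" using g by (intro sum_mono2) auto
  finally have "(\<Sum>i\<in>T - S. (row i B \<bullet> z)\<^sup>2) \<le> (\<Sum>i\<in>S - T. (row i B \<bullet> z)\<^sup>2)" .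
  then show ?thesis
    using sum.Int_Diff[of T "\<lambda>i. (row i B \<bullet> z)\<^sup>2" S] sum.Int_Diff[of S "\<lambda>i. (row i B \<bullet> z)\<^sup>2" T]
    by (simp add: Int_commute)
qed

text \<open>The normal of the hyperplane with index \<open>(i, j)\<close>; every unordered pair occurs in both
  orders, once for each of its two hyperplanes.\<close>
definition normal :: "real^'r^('n::{finite,linorder}) \<Rightarrow> 'n \<times> 'n \<Rightarrow> real^'r"
  where "normal B = (\<lambda>(i, j). if i < j then row i B - row j B else row j B + row i B)"

abbreviation normals :: "real^'r^('n::{finite,linorder}) \<Rightarrow> (real^'r) set"
  where "normals B \<equiv> normal B ` {(i, j). i \<noteq> j}"

lemma Union_hyperplanes: "\<Union> (hyperplanes B) = (\<Union>a\<in>normals B. {z. a \<bullet> z = 0})"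
proof (intro equalityI subsetI)
  fix z assume "z \<in> \<Union> (hyperplanes B)"
  then obtain i j where ij: "i < j" "(row i B - row j B) \<bullet> z = 0 \<or> (row i B + row j B) \<bullet> z = 0"
    by (auto simp: hyperplanes_def)
  then have "normal B (i, j) \<bullet> z = 0 \<or> normal B (j, i) \<bullet> z = 0"
    by (auto simp: normal_def)
  then show "z \<in> (\<Union>a\<in>normals B. {z. a \<bullet> z = 0})" using ij(1) by force
next
  fix z assume "z \<in> (\<Union>a\<in>normals B. {z. a \<bullet> z = 0})"
  then obtain i j where ij: "i \<noteq> j" "normal B (i, j) \<bullet> z = 0" by auto
  show "z \<in> \<Union> (hyperplanes B)"
  proof (cases "i < j")
    case True
    then show ?thesis using ij unfolding hyperplanes_def normal_def by auto
  next
    case False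
    then have "j < i" "(row j B + row i B) \<bullet> z = 0" using ij by (auto simp: normal_def)
    then show ?thesis unfolding hyperplanes_def by blast
  qed
qed

text \<open>There are \<open>n * (n - 1)\<close> ordered pairs off the diagonal; distinct pairs may
  share a normal, hence only an upper bound.\<close>

lemma card_normals_le: "card (normals (B::real^'r^('n::{finite,linorder}))) \<le> CARD('n) * (CARD('n) - 1)"
proof -
  have "{(i::'n, j). i \<noteq> j} = UNIV - range (\<lambda>i. (i, i))" by auto
  then have "card {(i::'n, j). i \<noteq> j} = CARD('n) * CARD('n) - CARD('n)"
    by (simp add: card_Diff_subset card_image inj_on_def card_prod)
  then show ?thesis
    using card_image_le[of "{(i::'n, j). i \<noteq> j}" "normal B"] by (simp add: diff_mult_distrib2)
qed

text \<open>The difference of two squares factors into the values of the two normals, so comparing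
  magnitudes needs only their signs.\<close>

lemma abs_less_iff_normals:
  assumes "i < j"
  shows "\<bar>row j B \<bullet> z\<bar> < \<bar>row i B \<bullet> z\<bar> \<longleftrightarrow> 0 < (normal B (i, j) \<bullet> z) * (normal B (j, i) \<bullet> z)"
proof -
  have "\<bar>row j B \<bullet> z\<bar> < \<bar>row i B \<bullet> z\<bar> \<longleftrightarrow> (row j B \<bullet> z)\<^sup>2 < (row i B \<bullet> z)\<^sup>2"
    by (metis abs_le_square_iff not_less)
  also have "\<dots> \<longleftrightarrow> 0 < (normal B (i, j) \<bullet> z) * (normal B (j, i) \<bullet> z)"
    using assms by (auto simp: normal_def inner_diff_left inner_add_left algebra_simps power2_eq_square)
  finally show ?thesis .
qed

lemma abs_neq_off_hyperplanes:
  assumes "i \<noteq> j" "z \<notin> \<Union> (hyperplanes B)"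
  shows "\<bar>row i B \<bullet> z\<bar> \<noteq> \<bar>row j B \<bullet> z\<bar>"
proof -
  have "normal B (i, j) \<in> normals B" "normal B (j, i) \<in> normals B" using assms(1) by auto
  then have "normal B (i, j) \<bullet> z \<noteq> 0" "normal B (j, i) \<bullet> z \<noteq> 0"
    using assms(2) unfolding Union_hyperplanes by blast+
  then show ?thesis using assms(1)
    by (auto simp: normal_def inner_simps abs_eq_iff split: if_splits)
qed

text \<open>Off the hyperplanes there are no ties, so a top support depends only on strict
  comparisons, and the signs of the normals decide these.\<close>

lemma top_support_same_signs:
  assumes yz: "y \<notin> \<Union> (hyperplanes B)" "z \<notin> \<Union> (hyperplanes B)"
    and same: "\<And>a. a \<in> normals B \<Longrightarrow> 0 < a \<bullet> y \<longleftrightarrow> 0 < a \<bullet> z"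
    and S: "is_top_support B k y S"
  shows "is_top_support B k z S"
proof -
  have key: "\<bar>row j B \<bullet> y\<bar> < \<bar>row i B \<bullet> y\<bar> \<longleftrightarrow> \<bar>row j B \<bullet> z\<bar> < \<bar>row i B \<bullet> z\<bar>" if "i < j" for i j
  proof -
    have n: "normal B (i, j) \<in> normals B" "normal B (j, i) \<in> normals B" using that by auto
    then have "normal B (i, j) \<bullet> y \<noteq> 0" "normal B (i, j) \<bullet> z \<noteq> 0"
      "normal B (j, i) \<bullet> y \<noteq> 0" "normal B (j, i) \<bullet> z \<noteq> 0"
      using yz unfolding Union_hyperplanes by blast+
    then show ?thesis using same[OF n(1)] same[OF n(2)] that
      unfolding abs_less_iff_normals[OF that] by (auto simp: zero_less_mult_iff)
  qed
  have "\<bar>row j B \<bullet> z\<bar> \<le> \<bar>row i B \<bullet> z\<bar>" if "i \<in> S" "j \<in> - S" for i j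
  proof -
    have ne: "i \<noteq> j" using that by blast
    have "\<bar>row j B \<bullet> y\<bar> \<le> \<bar>row i B \<bullet> y\<bar>"
      using S that by (simp add: is_top_support_def matrix_vector_nth)
    then have "\<bar>row j B \<bullet> y\<bar> < \<bar>row i B \<bullet> y\<bar>"
      using abs_neq_off_hyperplanes[OF ne yz(1)] by linarith
    then show ?thesis
      using key[of i j] key[of j i] ne abs_neq_off_hyperplanes[OF ne yz(2)]
      by (cases i j rule: linorder_cases) auto
  qed
  then show ?thesis using S by (simp add: is_top_support_def matrix_vector_nth)
qed

text \<open>Distinct sets of equal size have elements \<open>i\<close> and \<open>j\<close> in the
  two differences, and these would be tied.\<close>

lemma top_support_unique:
  assumes z: "z \<notin> \<Union> (hyperplanes B)" and S: "is_top_support B k z S" and T: "is_top_support B k z T"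
  shows "S = T"
proof (rule ccontr)
  assume "S \<noteq> T"
  moreover have "card S = card T" using S T by (simp add: is_top_support_def)
  ultimately have "\<not> S \<subseteq> T" "\<not> T \<subseteq> S" by (metis card_subset_eq finite)+
  then obtain i j where ij: "i \<in> S" "i \<notin> T" "j \<in> T" "j \<notin> S" by blast
  then have "\<bar>row j B \<bullet> z\<bar> \<le> \<bar>row i B \<bullet> z\<bar>" "\<bar>row i B \<bullet> z\<bar> \<le> \<bar>row j B \<bullet> z\<bar>"
    using S T by (auto simp: is_top_support_def matrix_vector_nth)
  moreover have "i \<noteq> j" using ij by blast
  ultimately show False using abs_neq_off_hyperplanes[of i j z B] z by linarith
qed

section \<open>Cells, observed supports and their number\<close>

lemma connected_inner_same_sign:
  fixes a :: "'a::real_inner"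
  assumes "connected C" "\<And>z. z \<in> C \<Longrightarrow> a \<bullet> z \<noteq> 0" "x \<in> C" "y \<in> C"
  shows "0 < a \<bullet> x \<longleftrightarrow> 0 < a \<bullet> y"
proof -
  have "0 < a \<bullet> q" if "p \<in> C" "q \<in> C" "0 < a \<bullet> p" for p q
  proof (rule ccontr)
    assume "\<not> 0 < a \<bullet> q"
    then have "\<exists>z\<in>C. a \<bullet> z = 0"
      using connected_ivt_hyperplane[OF assms(1) that(2,1), of a 0] that by auto
    then show False using assms(2) by blast
  qed
  then show ?thesis using assms(3,4) by blast
qed

text \<open>No normal vanishes on the cell of \<open>z\<close>, so all signs are constant there and
  the top support at \<open>z\<close> serves the whole cell.\<close>

lemma top_support_observed:
  assumes z: "z \<notin> \<Union> (hyperplanes B)" and S: "is_top_support B k z S"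
  shows "S \<in> observed_supports B k"
proof -
  define C where "C = connected_component_set (- \<Union> (hyperplanes B)) z"
  have C: "C \<in> cells B" "z \<in> C" "connected C" "C \<subseteq> - \<Union> (hyperplanes B)"
    using z by (auto simp: cells_def C_def components_def connected_component_subset)
  have "is_top_support B k y S" if y: "y \<in> C" for y
  proof (rule top_support_same_signs[OF _ _ _ S])
    fix a assume a: "a \<in> normals B"
    show "0 < a \<bullet> z \<longleftrightarrow> 0 < a \<bullet> y"
      using C(3) _ C(2) y
    proof (rule connected_inner_same_sign)
      fix p assume "p \<in> C"
      then show "a \<bullet> p \<noteq> 0" using a C(4) unfolding Union_hyperplanes by blast
    qed
  qed (use z y C in auto)
  then show ?thesis using C(1) by (auto simp: observed_supports_def)
qed

text \<open>Cells are nonempty, so the condition on all points of a cell is never vacuous.\<close>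

lemma observed_supportE:
  assumes "S \<in> observed_supports B k"
  obtains z where "z \<notin> \<Union> (hyperplanes B)" "is_top_support B k z S"
proof -
  obtain C where C: "C \<in> components (- \<Union> (hyperplanes B))" "\<forall>z\<in>C. is_top_support B k z S"
    using assms by (auto simp: observed_supports_def cells_def)
  then obtain z where "z \<in> C" using in_components_nonempty by blast
  then show thesis using that C in_components_subset by blast
qed

text \<open>Each support is sent to the sign pattern of a chosen generic point \<open>p S\<close>.
  The pattern determines the top support, so this map is injective.\<close>

lemma card_observed_supports_le:
  fixes B :: "real^'r^('n::{finite,linorder})"
  shows "card (observed_supports B k) \<le> Rc (CARD('n) * (CARD('n) - 1)) CARD('r)"
proof -
  have "\<forall>S\<in>observed_supports B k. \<exists>z. z \<notin> \<Union> (hyperplanes B) \<and> is_top_support B k z S"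
    using observed_supportE by blast
  then obtain p where p: "\<And>S. S \<in> observed_supports B k \<Longrightarrow>
      p S \<notin> \<Union> (hyperplanes B) \<and> is_top_support B k (p S) S"
    by (auto dest!: bchoice)
  define g where "g = (\<lambda>S. {a\<in>normals B. 0 < a \<bullet> p S})"
  have inj: "inj_on g (observed_supports B k)"
  proof (rule inj_onI)
    fix S T assume S: "S \<in> observed_supports B k" and T: "T \<in> observed_supports B k" and "g S = g T"
    then have "\<And>a. a \<in> normals B \<Longrightarrow> 0 < a \<bullet> p S \<longleftrightarrow> 0 < a \<bullet> p T" unfolding g_def by blast
    then have "is_top_support B k (p T) S"
      using p[OF S] p[OF T] by (blast intro: top_support_same_signs[of "p S" B "p T"])
    then show "S = T" using p[OF T] top_support_unique by blast
  qed
  have "g S \<in> sign_patterns UNIV (normals B)" if "S \<in> observed_supports B k" for S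
    using p[OF that] unfolding Union_hyperplanes sign_patterns_def g_def by blast
  then have "g ` observed_supports B k \<subseteq> sign_patterns UNIV (normals B)" by blast
  with inj have "card (observed_supports B k) \<le> card (sign_patterns UNIV (normals B))"
    by (rule card_inj_on_le) (simp add: finite_sign_patterns)
  also have "\<dots> \<le> cover_count (card (normals B)) CARD('r)"
    by (rule card_sign_patterns_le) auto
  also have "\<dots> \<le> Rc (CARD('n) * (CARD('n) - 1)) CARD('r)"
    by (rule cover_count_le_Rc[OF card_normals_le]) simp
  finally show ?thesis .
qed

section \<open>Density of generic points and the upper bound\<close>

text \<open>Since rows differ and are not opposite, all normals are nonzero; finitely many genuine
  hyperplanes form a null set, which has empty interior.\<close>

lemma closure_Compl_hyperplanes:
  assumes "\<And>i j. i \<noteq> j \<Longrightarrow> row i B \<noteq> row j B \<and> row i B \<noteq> - row j B"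
  shows "closure (- \<Union> (hyperplanes B)) = UNIV"
proof -
  have "0 \<notin> normals B"
  proof
    assume "0 \<in> normals B"
    then obtain i j where "i \<noteq> j" "normal B (i, j) = 0" by auto
    then show False using assms[of i j] assms[of j i]
      by (auto simp: normal_def add_eq_0_iff split: if_splits)
  qed
  then have "negligible (\<Union> (hyperplanes B))"
    unfolding Union_hyperplanes by (intro negligible_Union) (auto intro: negligible_hyperplane)
  then have "interior (\<Union> (hyperplanes B)) = {}"
    by (meson interior_subset negligible_subset open_interior open_not_negligible)
  then show ?thesis by (simp add: closure_complement)
qed

text \<open>Off the hyperplanes the top support at \<open>z\<close> is observed; the bound passes to the closure,
  so no tie-breaking is needed on the hyperplanes.\<close>
lemma sum_squares_le_observed:
  fixes B :: "real^'r^('n::{finite,linorder})"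
  assumes "\<And>i j. i \<noteq> j \<Longrightarrow> row i B \<noteq> row j B \<and> row i B \<noteq> - row j B"
    and "k \<le> CARD('n)" "card T \<le> k"
    and M: "\<And>S. S \<in> observed_supports B k \<Longrightarrow> lambda_max (rows_gram B S) \<le> M"
  shows "(\<Sum>i\<in>T. (row i B \<bullet> z)\<^sup>2) \<le> M * (norm z)\<^sup>2"
proof -
  have generic: "(\<Sum>i\<in>T. (row i B \<bullet> y)\<^sup>2) \<le> M * (norm y)\<^sup>2" if y: "y \<in> - \<Union> (hyperplanes B)" for y
  proof -
    obtain S where S: "is_top_support B k y S" using top_support_exists assms(2) by blast
    have "(\<Sum>i\<in>T. (row i B \<bullet> y)\<^sup>2) \<le> y \<bullet> (rows_gram B S *v y)"
      unfolding rows_gram_quadratic using S assms(3) by (rule top_support_sum_max)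
    also have "\<dots> \<le> lambda_max (rows_gram B S) * (norm y)\<^sup>2"
      by (rule rayleigh_le_lambda_max[OF rows_gram_symmetric])
    also have "\<dots> \<le> M * (norm y)\<^sup>2"
      using M[OF top_support_observed[OF _ S]] y by (intro mult_right_mono) auto
    finally show ?thesis .
  qed
  have "closed {y. (\<Sum>i\<in>T. (row i B \<bullet> y)\<^sup>2) \<le> M * (norm y)\<^sup>2}"
    by (intro closed_Collect_le continuous_intros)
  then have "closure (- \<Union> (hyperplanes B)) \<subseteq> {y. (\<Sum>i\<in>T. (row i B \<bullet> y)\<^sup>2) \<le> M * (norm y)\<^sup>2}"
    using generic by (intro closure_minimal) auto
  then show ?thesis using closure_Compl_hyperplanes[OF assms(1)] by blast
qed

theorem theorem6p2:
  fixes B :: "real^'r^('n::{finite,linorder})" and k :: nat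
  assumes "rank B = CARD('r)"
    and "1 \<le> k" and "k \<le> CARD('n)"
    and "\<And>i. row i B \<noteq> 0"
    and "\<And>i j. i \<noteq> j \<Longrightarrow> row i B \<noteq> row j B \<and> row i B \<noteq> - row j B"
  shows "observed_supports B k \<noteq> {}
    \<and> is_spca_optimal_value B k (Max ((\<lambda>S. lambda_max (rows_gram B S)) ` observed_supports B k))
    \<and> card (observed_supports B k) \<le> Rc (CARD('n) * (CARD('n) - 1)) CARD('r)
    \<and> (\<lambda>n. real (Rc (n * (n - 1)) CARD('r))) \<in> O(\<lambda>n. real n ^ (2 * CARD('r) - 2))"
proof (intro conjI)
  let ?L = "\<lambda>S. lambda_max (rows_gram B S)"
  define M where "M = Max (?L ` observed_supports B k)"
  have "- \<Union> (hyperplanes B) \<noteq> {}"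
    using closure_Compl_hyperplanes[OF assms(5)] by force
  then obtain z S where "z \<notin> \<Union> (hyperplanes B)" "is_top_support B k z S"
    using top_support_exists[OF assms(3)] by blast
  then show ne: "observed_supports B k \<noteq> {}" using top_support_observed by blast
  have M_ge: "?L S \<le> M" if "S \<in> observed_supports B k" for S
    unfolding M_def using that by (intro Max_ge) auto
  have "M \<in> ?L ` observed_supports B k" unfolding M_def using ne by (intro Max_in) auto
  then obtain S where S: "S \<in> observed_supports B k" "M = ?L S" by blast
  have cS: "card S = k" using S(1) by (auto elim: observed_supportE simp: is_top_support_def)
  \<comment> \<open>As \<open>k\<close> is positive, \<open>S\<close> contains some
    \<open>i\<close>. Testing the quadratic form at the nonzero row \<open>i\<close> forces
    \<open>M > 0\<close>, which the normalisation of the maximiser relies on.\<close>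
  then obtain i where i: "i \<in> S" using assms(2) by fastforce
  have "0 < (row i B \<bullet> row i B)\<^sup>2" using assms(4)[of i] by simp
  also have "\<dots> \<le> (\<Sum>j\<in>S. (row j B \<bullet> row i B)\<^sup>2)" using i by (intro member_le_sum) auto
  also have "\<dots> \<le> M * (norm (row i B))\<^sup>2"
    using rayleigh_le_lambda_max[OF rows_gram_symmetric, of "row i B" B S] S(2)
    by (simp add: rows_gram_quadratic)
  finally have M_pos: "0 < M" using assms(4)[of i] by (simp add: zero_less_mult_iff)
  have "M \<in> eigenvalues (rows_gram B S)"
    using S(2) lambda_max_eigenvalue[OF rows_gram_symmetric] by simp
  then obtain x where x: "x \<in> spca_feasible k" "spca_objective B x = M"
    using spca_attains_eigenvalue[OF _ M_pos] cS by blast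
  have "spca_objective B y \<le> M" if y: "y \<in> spca_feasible k" for y
  proof -
    \<comment> \<open>With the support of \<open>y\<close> as index set the two estimates bound the
      fourth power of \<open>norm ?w\<close> by \<open>M\<close> times its square. The square is
      cancelled; if \<open>?w = 0\<close>, the claim follows from \<open>0 < M\<close>.\<close>
    let ?w = "transpose B *v y"
    have "(norm ?w) ^ 4 \<le> (\<Sum>i\<in>{i. y $ i \<noteq> 0}. (row i B \<bullet> ?w)\<^sup>2)"
      using y by (intro norm_transpose_mult_le) (auto simp: spca_feasible_def)
    also have "\<dots> \<le> M * (norm ?w)\<^sup>2"
      using y M_ge by (intro sum_squares_le_observed[OF assms(5,3)]) (auto simp: spca_feasible_def nnz_def)
    finally have "(norm ?w)\<^sup>2 * (norm ?w)\<^sup>2 \<le> M * (norm ?w)\<^sup>2"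
      by (simp only: power_add[symmetric]) simp
    then show ?thesis unfolding spca_objective_eq
      using M_pos mult_right_le_imp_le[of "(norm ?w)\<^sup>2" "(norm ?w)\<^sup>2" M]
      by (cases "?w = 0") (simp_all del: transpose_matrix_vector)
  qed
  then show "is_spca_optimal_value B k M"
    using x unfolding is_spca_optimal_value_def by blast
  show "card (observed_supports B k) \<le> Rc (CARD('n) * (CARD('n) - 1)) CARD('r)"
    by (rule card_observed_supports_le)
  show "(\<lambda>n. real (Rc (n * (n - 1)) CARD('r))) \<in> O(\<lambda>n. real n ^ (2 * CARD('r) - 2))"
    by (rule Rc_pairs_bigo) simp
qed

end
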